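(* Let $A\in\mathbb{C}^{n\times n}$ be a Hermitian matrix, let $p<n$ and $\mu_1>16p\,\|A\|_2$ with $\mu_1>0$, and consider the problem (qL1M) $$\min_{X\in\mathcal{OB}(n,p)} E_1(X)=\mathrm{tr}(X^*AX)+\mu_1\sum_{1\le i<j\le p}\big|(X^*X)_{ij}\big| .$$ Every local minimizer of qL1M is of the form $X=Q_pV^*$, where $V\in\mathbb{C}^{p\times p}$ is a unitary matrix and $Q_p\in\mathbb{C}^{n\times p}$ consists of (orthonormal) eigenvectors of the $p$ smallest eigenvalues of $A$ (counting geometric multiplicity). Conversely, any matrix of the form $Q_pV^*$, with such $Q_p$ and an arbitrary unitary $V\in\mathbb{C}^{p\times p}$, is a local minimizer of qL1M. Furthermore, any local minimum of qL1M is also a global minimum.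
   Context: Here $p\ge1$ is an integer, $X^*$ denotes the conjugate transpose, and $\|A\|_2$ is the spectral norm. The oblique manifold is $\mathcal{OB}(n,p)=\{X\in\mathbb{C}^{n\times p}:\ (X^*X)_{jj}=1 \text{ for } j=1,\dots,p\}$. Local minimizers are understood relative to the constraint set $\mathcal{OB}(n,p)$ (with the topology of the Frobenius norm). Order the eigenvalues of $A$ with multiplicity as $\lambda_1\le\lambda_2\le\dots\le\lambda_n$. "Eigenvectors of the $p$ smallest eigenvalues" means that $Q_p^*Q_p=I$ and $AQ_p=Q_p\Lambda_p$ with $\Lambda_p=\mathrm{diag}(\lambda_1,\dots,\lambda_p)$; if $\lambda_p=\lambda_{p+1}$ this choice is not unique, and any valid choice of eigenvectors is included. *)

theory Defs
  imports "HOL-Analysis.Analysis" "HOL-Library.Multiset"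
begin

definition ctranspose :: "complex^'p^'n \<Rightarrow> complex^'n^'p" where
  "ctranspose X = (\<chi> i j. cnj (X $ j $ i))"

definition hermitian :: "complex^'n^'n \<Rightarrow> bool" where
  "hermitian A \<longleftrightarrow> ctranspose A = A"

definition unitary :: "complex^'n^'n \<Rightarrow> bool" where
  "unitary V \<longleftrightarrow> ctranspose V ** V = mat 1 \<and> V ** ctranspose V = mat 1"

text \<open>The norm on \<open>complex^'n\<close> is the Euclidean one, so \<^const>\<open>onorm\<close> gives the spectral norm.\<close>

definition spectral_norm :: "complex^'m^'n \<Rightarrow> real" where
  "spectral_norm A = onorm (\<lambda>x. A *v x)"

definition oblique :: "(complex^'p^'n) set" where
  "oblique = {X. \<forall>j. (ctranspose X ** X) $ j $ j = 1}"

text \<open>The trace is real for Hermitian \<open>A\<close> (see \<open>trace_quadratic_real\<close> below), so taking \<^const>\<open>Re\<close>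
  only changes the type. The linear order on the column index type makes the sum over
  \<open>i < j\<close> run over each unordered pair of distinct columns once.\<close>

definition qL1M_energy ::
    "complex^'n^'n \<Rightarrow> real \<Rightarrow> complex^('p::{finite,linorder})^'n \<Rightarrow> real" where
  "qL1M_energy A \<mu> X =
     Re (trace (ctranspose X ** A ** X)) +
     \<mu> * (\<Sum>(i, j)\<in>{(i, j). i < j}. cmod ((ctranspose X ** X) $ i $ j))"

text \<open>The topology on \<open>complex^'p^'n\<close> is that of the Frobenius norm.\<close>

definition local_minimizer_on :: "('a::topological_space \<Rightarrow> real) \<Rightarrow> 'a set \<Rightarrow> 'a \<Rightarrow> bool" where
  "local_minimizer_on f S x \<longleftrightarrow> x \<in> S \<and> (\<forall>\<^sub>F y in at x within S. f x \<le> f y)"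

definition eigenspace :: "complex^'n^'n \<Rightarrow> complex \<Rightarrow> (complex^'n) set" where
  "eigenspace A e = {v. A *v v = e *s v}"

text \<open>\<open>es\<close> lists the eigenvalues of a Hermitian matrix in ascending order, each repeated according
  to its geometric multiplicity; \<^term>\<open>vec.dim\<close> is the dimension over the complex field (plain
  \<^const>\<open>dim\<close> would be the real dimension).\<close>

definition ordered_eigenvalues :: "complex^'n^'n \<Rightarrow> real list \<Rightarrow> bool" where
  "ordered_eigenvalues A es \<longleftrightarrow>
     sorted es \<and> length es = CARD('n) \<and>
     (\<forall>e. count_list es e = vec.dim (eigenspace A (complex_of_real e)))"

text \<open>\<open>Q\<close> has orthonormal columns and \<open>A ** Q = Q ** \<Lambda>\<close>, where \<open>\<Lambda>\<close> is the diagonal matrix of the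
  smallest eigenvalues in ascending order: the number of indices below \<open>j\<close> is the zero-based
  position of column \<open>j\<close>, hence of its eigenvalue in \<open>es\<close>. Since \<open>es\<close> is unique, the existential
  quantifier involves no choice; \<open>Q\<close> itself is not unique.\<close>

definition smallest_eigenvectors ::
    "complex^'n^'n \<Rightarrow> complex^('p::{finite,linorder})^'n \<Rightarrow> bool" where
  "smallest_eigenvectors A Q \<longleftrightarrow>
     ctranspose Q ** Q = mat 1 \<and>
     (\<exists>es. ordered_eigenvalues A es \<and>
        A ** Q = Q ** (\<chi> i j. if i = j then complex_of_real (es ! card {k. k < j}) else 0))"

lemma ordered_eigenvalues_unique:
  assumes "ordered_eigenvalues A es" "ordered_eigenvalues A fs"
  shows "es = fs"
proof -
  have "mset es = mset fs"
    using assms by (intro multiset_eqI) (simp add: ordered_eigenvalues_def count_mset)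
  then show ?thesis
    using assms by (metis ordered_eigenvalues_def properties_for_sort)
qed

lemma trace_quadratic_real:
  fixes X :: "complex^'p^'n"
  assumes "hermitian A"
  shows "trace (ctranspose X ** A ** X) \<in> \<real>"
proof -
  have A: "cnj (A $ i $ j) = A $ j $ i" for i j
    using assms unfolding hermitian_def ctranspose_def by (metis vec_lambda_beta)
  have eq: "trace (ctranspose X ** A ** X) =
      (\<Sum>k\<in>UNIV. \<Sum>j\<in>UNIV. \<Sum>i\<in>UNIV. cnj (X $ i $ k) * A $ i $ j * X $ j $ k)"
    by (simp add: trace_def ctranspose_def matrix_matrix_mult_def sum_distrib_right)
  have "cnj (trace (ctranspose X ** A ** X)) =
      (\<Sum>k\<in>UNIV. \<Sum>j\<in>UNIV. \<Sum>i\<in>UNIV. cnj (X $ j $ k) * A $ j $ i * X $ i $ k)"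
    unfolding eq by (simp add: A mult_ac)
  also have "\<dots> = trace (ctranspose X ** A ** X)"
    unfolding eq by (rule sum.cong[OF refl], rule sum.swap)
  finally show ?thesis
    by (simp add: Reals_cnj_iff)
qed

end

theory Submission
  imports Defs
begin

text \<open>The energy has a direct descent path away from every \<open>X\<close> whose columns are not orthonormal. With a
  polar decomposition \<open>X = Z P\<close> and Gram matrix \<open>G = P\<^sup>2\<close>, let \<open>X(t) = Z S(t)\<close>, where \<open>S(t)\<close> is the
  positive square root of \<open>(1 - t) G + t I\<close>. This path stays in the oblique manifold, the trace term
  equals \<open>tr (Z\<^sup>* A Z ((1 - t) G + t I))\<close>, and so the energy is affine in \<open>t\<close>; the penalty dominates its
  slope as soon as \<open>\<mu> > 2 \<parallel>A\<parallel>\<close>. Hence local minimizers have orthonormal columns.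
  Rotating one column of \<open>Q = X V\<close>, where \<open>V\<close> diagonalizes \<open>X\<^sup>* A X\<close>, towards a vector orthogonal to all
  columns then shows that the columns of \<open>Q\<close> are eigenvectors and that their eigenvalues bound the
  quadratic form on the orthogonal complement from below. All matrices \<open>Q\<^sub>p V\<^sup>*\<close> have the same energy,
  and by compactness one of them is a global minimizer.\<close>

subsection \<open>The Hermitian inner product\<close>

text \<open>Conjugating the first argument makes the entries of \<open>ctranspose X ** Y\<close> the
  products of columns; the real part is the real inner product.\<close>

definition cdot :: "complex^'n \<Rightarrow> complex^'n \<Rightarrow> complex" where
  "cdot x y = (\<Sum>i\<in>UNIV. cnj (x $ i) * y $ i)"

lemma cdot_zero [simp]: "cdot 0 y = 0" "cdot x 0 = 0"
  by (simp_all add: cdot_def)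

lemma cdot_add_left: "cdot (x + y) z = cdot x z + cdot y z"
  and cdot_add_right: "cdot x (y + z) = cdot x y + cdot x z"
  and cdot_diff_right: "cdot x (y - z) = cdot x y - cdot x z"
  by (simp_all add: cdot_def algebra_simps sum.distrib sum_subtractf)

lemma cdot_smult_left: "cdot (c *s x) y = cnj c * cdot x y"
  and cdot_smult_right: "cdot x (c *s y) = c * cdot x y"
  and cdot_scaleR_left: "cdot (r *\<^sub>R x) y = of_real r * cdot x y"
  and cdot_scaleR_right: "cdot x (r *\<^sub>R y) = of_real r * cdot x y"
  unfolding cdot_def vector_scaleR_component vector_smult_component
  by (simp_all add: sum_distrib_left mult_ac scaleR_conv_of_real)

lemma cdot_sum_right: "cdot x (\<Sum>i\<in>I. f i) = (\<Sum>i\<in>I. cdot x (f i))"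
  by (induction I rule: infinite_finite_induct) (simp_all add: cdot_add_right)

lemma cnj_cdot: "cnj (cdot x y) = cdot y x"
  by (simp add: cdot_def mult_ac)

lemma cdot_eq_zero_commute: "cdot x y = 0 \<longleftrightarrow> cdot y x = 0"
  by (metis cnj_cdot complex_cnj_zero_iff)

lemma Re_cdot: "Re (cdot x y) = x \<bullet> y"
  by (simp add: cdot_def inner_vec_def inner_complex_def)

lemma cdot_self: "cdot x x = of_real ((norm x)\<^sup>2)"
proof -
  have "Im (cdot x x) = 0"
    using cnj_cdot[of x x] by (simp add: complex_eq_iff)
  then show ?thesis
    by (simp add: complex_eq_iff Re_cdot power2_norm_eq_inner)
qed

lemma norm_eq_1_iff_cdot: "norm x = 1 \<longleftrightarrow> cdot x x = 1"
  unfolding cdot_self power2_norm_eq_inner norm_eq_1 by simp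

lemma cmod_cdot_le: "cmod (cdot x y) \<le> norm x * norm y"
proof -
  \<comment> \<open>The phase \<open>c\<close> turns \<open>cdot x y\<close> into its modulus, which
    leaves the real Cauchy-Schwarz inequality. Since \<open>sgn 0 = 0\<close>, \<open>c\<close> may
    vanish, hence only an inequality for the norm of \<open>c *s y\<close>.\<close>
  define c where "c = cnj (sgn (cdot x y))"
  have "cdot x (c *s y) = cmod (cdot x y)"
    by (simp add: c_def cdot_smult_right sgn_eq mult.commute complex_norm_square[symmetric] power2_eq_square)
  then have "cmod (cdot x y) = x \<bullet> (c *s y)"
    by (metis Re_cdot Re_complex_of_real)
  also have "\<dots> \<le> norm x * norm (c *s y)"
    by (rule norm_cauchy_schwarz)
  also have "norm (c *s y) \<le> norm y"
    by (rule norm_le_componentwise_cart) (simp add: c_def norm_mult norm_sgn)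
  finally show ?thesis by (simp add: mult_left_mono)
qed

lemma cdot_adjoint: "cdot (A *v x) y = cdot x (ctranspose A *v y)"
proof -
  have "cdot (A *v x) y = (\<Sum>i\<in>UNIV. \<Sum>j\<in>UNIV. cnj (x $ j) * (cnj (A $ i $ j) * y $ i))"
    by (simp add: cdot_def matrix_vector_mult_def sum_distrib_right sum_distrib_left mult_ac)
  also have "\<dots> = cdot x (ctranspose A *v y)"
    by (subst sum.swap) (simp add: cdot_def matrix_vector_mult_def ctranspose_def sum_distrib_left)
  finally show ?thesis .
qed

lemma cdot_hermitian: "hermitian A \<Longrightarrow> cdot (A *v x) y = cdot x (A *v y)"
  by (simp add: cdot_adjoint hermitian_def)

lemma ctranspose_ctranspose [simp]: "ctranspose (ctranspose X) = X"
  by (simp add: ctranspose_def vec_eq_iff)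

lemma ctranspose_mul: "ctranspose (X ** Y) = ctranspose Y ** ctranspose X"
  by (simp add: ctranspose_def matrix_matrix_mult_def vec_eq_iff mult.commute)

lemma ctranspose_mul_nth: "(ctranspose X ** Y) $ i $ j = cdot (column i X) (column j Y)"
  by (simp add: ctranspose_def matrix_matrix_mult_def cdot_def column_def)

lemma column_mul: "column j (X ** Y) = X *v column j Y"
  by (simp add: column_def matrix_matrix_mult_def matrix_vector_mult_def)

lemma ctranspose_mul_mul_nth:
  "(ctranspose X ** A ** X) $ i $ j = cdot (column i X) (A *v column j X)"
  by (simp add: matrix_mul_assoc[symmetric] ctranspose_mul_nth column_mul)

section \<open>Quadratic forms and second-order conditions\<close>

definition qform :: "complex^'n^'n \<Rightarrow> complex^'n \<Rightarrow> real" where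
  "qform A x = Re (cdot x (A *v x))"

lemma matrix_vector_mult_scaleR_complex:
  fixes A :: "complex^'m^'n"
  shows "A *v (r *\<^sub>R x) = r *\<^sub>R (A *v x)"
  unfolding vec_eq_iff vector_scaleR_component matrix_vector_mult_def
  by (simp add: scaleR_sum_right)

lemma qform_scaleR: "qform A (r *\<^sub>R x) = r\<^sup>2 * qform A x"
  by (simp add: qform_def matrix_vector_mult_scaleR_complex cdot_scaleR_left cdot_scaleR_right power2_eq_square)

lemma qform_add_scaleR:
  assumes "hermitian A"
  shows "qform A (x + t *\<^sub>R y) = qform A x + 2 * t * Re (cdot y (A *v x)) + t\<^sup>2 * qform A y"
proof -
  have "cdot x (A *v y) = cnj (cdot y (A *v x))"
    using assms by (simp add: cnj_cdot cdot_hermitian)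
  then show ?thesis
    by (simp add: qform_def matrix_vector_mult_scaleR_complex matrix_vector_right_distrib cdot_scaleR_left
        cdot_scaleR_right cdot_add_left cdot_add_right power2_eq_square algebra_simps)
qed

lemma continuous_on_cdot [continuous_intros]:
  "continuous_on S f \<Longrightarrow> continuous_on S g \<Longrightarrow> continuous_on S (\<lambda>x. cdot (f x) (g x))"
  unfolding cdot_def by (intro continuous_intros)

lemma continuous_on_qform: "continuous_on S (qform A)"
  unfolding qform_def matrix_vector_mult_def by (intro continuous_intros)

text \<open>Dividing by small \<open>t\<close> of either sign and passing to the limit gives
  \<open>a = 0\<close>, after which a single small \<open>t\<close> gives the sign of
  \<open>b\<close>.\<close>

lemma quadratic_nonneg_near_zero:
  fixes a b :: real
  assumes "\<forall>\<^sub>F t in at 0. 0 \<le> t * a + t\<^sup>2 * b"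
  shows "a = 0 \<and> b \<ge> 0"
proof -
  obtain d where d: "d > 0" and nn: "\<And>t. t \<noteq> 0 \<Longrightarrow> \<bar>t\<bar> < d \<Longrightarrow> 0 \<le> t * a + t\<^sup>2 * b"
    using assms by (auto simp: eventually_at dist_real_def)
  have lim: "((\<lambda>t. c * a + t * b) \<longlongrightarrow> c * a) (at_right 0)" for c
    by (auto intro!: tendsto_eq_intros)
  have ev: "\<forall>\<^sub>F t in at_right 0. 0 < t \<and> t < d"
    using d by (simp add: eventually_at_right_less eventually_conj_iff eventually_at_right_real eventually_at_right_field)
       (use dense in blast)
  have "0 \<le> c * a" if "\<bar>c\<bar> = 1" for c
  proof (rule tendsto_lowerbound[OF lim])
    show "\<forall>\<^sub>F t in at_right 0. 0 \<le> c * a + t * b"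
      using ev
    proof eventually_elim
      case (elim t)
      have "0 \<le> (t * c) * a + (t * c)\<^sup>2 * b"
        by (rule nn) (use elim that in \<open>auto simp: abs_mult\<close>)
      also have "\<dots> = t * (c * a + t * b)"
        using that by (auto simp: abs_if power2_eq_square algebra_simps split: if_splits)
      finally show ?case using elim by (simp add: zero_le_mult_iff)
    qed
  qed simp
  from this[of 1] this[of "-1"] have "a = 0" by simp
  moreover have "0 \<le> b"
    using nn[of "d/2"] d \<open>a = 0\<close> by (simp add: zero_le_mult_iff)
  ultimately show ?thesis by simp
qed

subsection \<open>Eigenbases of Hermitian matrices\<close>

text \<open>Complex orthogonality to \<open>v i\<close> is real orthogonality to \<open>v i\<close>
  and \<open>\<i> *s v i\<close>: at most \<open>2 * card I\<close> real conditions in real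
  dimension \<open>2 * CARD('n)\<close>.\<close>

lemma exists_orthogonal_vector:
  fixes v :: "'i \<Rightarrow> complex^'n"
  assumes "finite I" "card I < CARD('n)"
  shows "\<exists>x. norm x = 1 \<and> (\<forall>i\<in>I. cdot (v i) x = 0)"
proof -
  define T where "T = v ` I \<union> (\<lambda>i. \<i> *s v i) ` I"
  have "dim T \<le> card T"
    using assms by (simp add: T_def dim_le_card')
  also have "\<dots> \<le> card I + card I"
    unfolding T_def using assms(1) by (meson card_Un_le card_image_le add_mono order_trans)
  finally have "dim T < DIM(complex^'n)"
    using assms by simp
  then obtain y where y: "y \<noteq> 0" "\<And>z. z \<in> span T \<Longrightarrow> orthogonal y z"
    using orthogonal_to_subspace_exists by blast
  have "cdot (v i) y = 0" if "i \<in> I" for i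
  proof -
    have "v i \<in> span T" "\<i> *s v i \<in> span T"
      using that by (auto simp: T_def intro!: span_base)
    then have "Re (cdot (v i) y) = 0" "Re (cdot (\<i> *s v i) y) = 0"
      using y(2) by (auto simp: orthogonal_def Re_cdot inner_commute[of _ y])
    then show ?thesis
      by (simp add: cdot_smult_left complex_eq_iff)
  qed
  then show ?thesis
    using y(1) by (intro exI[of _ "(1 / norm y) *\<^sub>R y"]) (simp add: cdot_scaleR_right)
qed

text \<open>The last condition makes the system extensible by Rayleigh minimization on the complement, so it
  can start from the columns of a local minimizer as well as from nothing.\<close>

definition greedy_eigensystem ::
    "complex^'n^'n \<Rightarrow> nat \<Rightarrow> (nat \<Rightarrow> complex^'n) \<Rightarrow> (nat \<Rightarrow> real) \<Rightarrow> bool" where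
  "greedy_eigensystem A m v l \<longleftrightarrow>
     (\<forall>i<m. \<forall>j<m. cdot (v i) (v j) = (if i = j then 1 else 0)) \<and>
     (\<forall>i<m. A *v v i = complex_of_real (l i) *s v i) \<and>
     (\<forall>i j. i \<le> j \<longrightarrow> j < m \<longrightarrow> l i \<le> l j) \<and>
     (\<forall>i<m. \<forall>w. (\<forall>k<m. cdot (v k) w = 0) \<longrightarrow> l i * (norm w)\<^sup>2 \<le> qform A w)"

text \<open>The new vector minimizes the quadratic form on the unit sphere of the complement
  \<open>C\<close> of the old ones; the minimum is the new eigenvalue.\<close>

lemma greedy_eigensystem_step:
  fixes A :: "complex^'n^'n"
  assumes A: "hermitian A" and g: "greedy_eigensystem A m v l" and m: "m < CARD('n)"
  shows "\<exists>x a. greedy_eigensystem A (Suc m) (v(m := x)) (l(m := a))"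
proof -
  define C where "C = {w. \<forall>k<m. cdot (v k) w = 0}"
  have C_lin: "x + t *\<^sub>R y \<in> C" if "x \<in> C" "y \<in> C" for x y t
    using that by (simp add: C_def cdot_add_right cdot_scaleR_right)
  have "closed C"
    unfolding C_def Collect_all_eq by (intro closed_INT closed_Collect_eq ballI)
     (auto intro!: closed_Collect_imp closed_Collect_eq continuous_intros)
  then have "compact (C \<inter> sphere 0 1)"
    by (simp add: closed_Int_compact)
  moreover have "C \<inter> sphere 0 1 \<noteq> {}"
    using exists_orthogonal_vector[of "{..<m}" v] m by (auto simp: C_def)
  ultimately obtain x where "x \<in> C \<inter> sphere 0 1"
    and le: "\<forall>y\<in>C \<inter> sphere 0 1. qform A x \<le> qform A y"
    using continuous_attains_inf[OF _ _ continuous_on_qform, of "C \<inter> sphere 0 1" A] by blast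
  then have x: "x \<in> C" "norm x = 1"
    by auto
  have x_min: "qform A x \<le> qform A y" if "y \<in> C" "norm y = 1" for y
    using le that by simp
  define a where "a = qform A x"
  have a_le: "a * (norm w)\<^sup>2 \<le> qform A w" if "w \<in> C" for w
  proof (cases "w = 0")
    case False
    have "a \<le> qform A ((1 / norm w) *\<^sub>R w)"
      unfolding a_def using that False by (intro x_min) (simp_all add: C_def cdot_scaleR_right)
    then show ?thesis
      using False by (simp add: qform_scaleR field_simps)
  qed (simp add: qform_def)
  \<comment> \<open>The residual lies in \<open>C\<close> because the \<open>v k\<close> are
    eigenvectors, so it is an admissible direction. The first variation along it is twice its
    squared norm, which must vanish.\<close>
  define r where "r = A *v x - complex_of_real a *s x"
  have r: "r \<in> C"
  proof -
    have "cdot (v k) (A *v x) = 0" if "k < m" for k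
    proof -
      have "cdot (v k) (A *v x) = cdot (A *v v k) x"
        using A by (simp add: cdot_hermitian)
      also have "\<dots> = 0"
        using g that x(1) by (simp add: greedy_eigensystem_def cdot_smult_left C_def)
      finally show ?thesis .
    qed
    then show ?thesis
      using x(1) by (simp add: r_def C_def cdot_diff_right cdot_smult_right)
  qed
  have "2 * Re (cdot r r) = 0 \<and> 0 \<le> qform A r - a * (norm r)\<^sup>2"
  proof (intro quadratic_nonneg_near_zero always_eventually allI)
    fix t :: real
    have n: "(norm (x + t *\<^sub>R r))\<^sup>2 = 1 + 2 * t * Re (cdot r x) + t\<^sup>2 * (norm r)\<^sup>2"
      using x(2) unfolding power2_norm_eq_inner Re_cdot norm_eq_1
      by (simp add: inner_simps inner_commute[of x r] power2_eq_square algebra_simps)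
    have "Re (cdot r r) = Re (cdot r (A *v x)) - a * Re (cdot r x)"
      by (subst (2) r_def) (simp add: cdot_diff_right cdot_smult_right)
    then have rA: "Re (cdot r (A *v x)) = Re (cdot r r) + a * Re (cdot r x)"
      by simp
    show "0 \<le> t * (2 * Re (cdot r r)) + t\<^sup>2 * (qform A r - a * (norm r)\<^sup>2)"
      using a_le[OF C_lin[OF x(1) r, of t]]
      unfolding n qform_add_scaleR[OF A] rA by (simp add: a_def algebra_simps)
  qed
  then have "r = 0"
    by (simp add: cdot_self)
  then have eig: "A *v x = complex_of_real a *s x"
    by (simp add: r_def)
  have orth: "cdot (v k) x = 0" "cdot x (v k) = 0" if "k < m" for k
    using that x(1) by (auto simp: C_def cdot_eq_zero_commute)
  \<comment> \<open>Testing the last condition of the old system at \<open>x\<close> shows that the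
    new eigenvalue is not below the earlier ones.\<close>
  have l_le: "l i \<le> a" if "i < m" for i
  proof -
    have "l i * (norm x)\<^sup>2 \<le> qform A x"
      using g that x(1) unfolding greedy_eigensystem_def C_def by blast
    then show ?thesis
      by (simp add: x(2) a_def)
  qed
  have "greedy_eigensystem A (Suc m) (v(m := x)) (l(m := a))"
    using g orth eig l_le a_le x(2)
    unfolding greedy_eigensystem_def less_Suc_eq C_def mem_Collect_eq
    by (auto simp: cdot_self)
  then show ?thesis by blast
qed

text \<open>One step adds a vector at index \<open>k\<close>, the induction hypothesis adds the
  rest, and entries below \<open>k\<close> stay. Keeping the start is what later puts the
  eigenvalues found at a minimizer first in the list.\<close>

lemma greedy_eigensystem_extend:
  fixes A :: "complex^'n^'n"
  assumes A: "hermitian A" and "greedy_eigensystem A m v l" "m \<le> CARD('n)"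
  shows "\<exists>v' l'. greedy_eigensystem A CARD('n) v' l' \<and> (\<forall>i<m. v' i = v i \<and> l' i = l i)"
  using assms(3,2)
proof (induction arbitrary: v l rule: inc_induct)
  case (step k)
  then obtain x a where "greedy_eigensystem A (Suc k) (v(k := x)) (l(k := a))"
    using greedy_eigensystem_step[OF A] by blast
  from step.IH[OF this] show ?case
    by (metis fun_upd_other less_SucI nat_neq_iff)
qed blast

lemma vec_independent_orthonormal:
  assumes "finite I" and on: "\<And>i j. i \<in> I \<Longrightarrow> j \<in> I \<Longrightarrow> cdot (v i) (v j) = (if i = j then 1 else 0)"
  shows "inj_on v I \<and> vec.independent (v ` I)"
proof
  show inj: "inj_on v I"
    by (rule inj_onI) (metis on zero_neq_one)
  have "u x = 0" if eq: "(\<Sum>x\<in>v ` I. u x *s x) = 0" and "x \<in> v ` I" for u x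
  proof -
    obtain j where j: "j \<in> I" "x = v j"
      using \<open>x \<in> v ` I\<close> by blast
    have "0 = cdot (v j) (\<Sum>i\<in>I. u (v i) *s v i)"
      using eq by (simp add: sum.reindex[OF inj])
    also have "\<dots> = (\<Sum>i\<in>I. if j = i then u (v i) else 0)"
      unfolding cdot_sum_right by (rule sum.cong) (auto simp: cdot_smult_right on j)
    finally show ?thesis
      using assms(1) j by simp
  qed
  then show "vec.independent (v ` I)"
    using assms(1) by (auto simp: vec.dependent_finite)
qed

text \<open>The \<open>v i\<close> form an orthonormal basis, and those with \<open>l i = e\<close>
  span the eigenspace of \<open>e\<close>, so counting them gives the multiplicity.\<close>

lemma greedy_eigensystem_imp_ordered_eigenvalues:
  fixes A :: "complex^'n^'n"
  assumes A: "hermitian A" and g: "greedy_eigensystem A CARD('n) v l"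
  shows "ordered_eigenvalues A (map l [0..<CARD('n)])"
proof -
  let ?n = "CARD('n)"
  have on: "cdot (v i) (v j) = (if i = j then 1 else 0)" if "i < ?n" "j < ?n" for i j
    using g that by (simp add: greedy_eigensystem_def)
  have eig: "A *v v i = complex_of_real (l i) *s v i" if "i < ?n" for i
    using g that by (simp add: greedy_eigensystem_def)
  have ind: "inj_on v {..<?n}" "vec.independent (v ` {..<?n})"
    using vec_independent_orthonormal[of "{..<?n}" v] on by auto
  then have span: "vec.span (v ` {..<?n}) = UNIV"
    using vec.card_ge_dim_independent[of "v ` {..<?n}" UNIV]
    by (auto simp: card_image card_cart_basis)
  have "count_list (map l [0..<?n]) e = vec.dim (eigenspace A (complex_of_real e))" for e
  proof -
    define I where "I = {i. i < ?n \<and> l i = e}"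
    have I: "finite I" "I \<subseteq> {..<?n}"
      by (auto simp: I_def)
    have "v ` I \<subseteq> eigenspace A (complex_of_real e)"
      by (auto simp: eigenspace_def I_def eig)
    moreover have "eigenspace A (complex_of_real e) \<subseteq> vec.span (v ` I)"
    proof
      fix x assume "x \<in> eigenspace A (complex_of_real e)"
      then have x: "A *v x = complex_of_real e *s x"
        by (simp add: eigenspace_def)
      obtain c where c: "x = (\<Sum>i<?n. c i *s v i)"
      proof -
        obtain u where "x = (\<Sum>w\<in>v ` {..<?n}. u w *s w)"
          using span vec.span_finite[of "v ` {..<?n}"] by blast
        then have "x = (\<Sum>i<?n. u (v i) *s v i)"
          by (simp add: sum.reindex[OF ind(1)])
        then show thesis by (rule that)
      qed
      \<comment> \<open>Pairing \<open>x\<close> with \<open>A *v v i\<close> and moving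
        \<open>A\<close> across gives \<open>l i * c i = e * c i\<close>.\<close>
      have "c i = 0 \<or> l i = e" if i: "i < ?n" for i
      proof -
        have ci: "cdot (v i) x = c i"
        proof -
          have "cdot (v i) x = (\<Sum>j<?n. if i = j then c j else 0)"
            unfolding c cdot_sum_right by (rule sum.cong) (auto simp: cdot_smult_right on i)
          then show ?thesis using i by simp
        qed
        have "cdot (A *v v i) x = cdot (v i) (A *v x)"
          using A by (rule cdot_hermitian)
        then show ?thesis
          using i by (simp add: eig x cdot_smult_left cdot_smult_right ci)
      qed
      then have "c i *s v i \<in> vec.span (v ` I)" if "i < ?n" for i
        using that by (cases "c i = 0") (force simp: I_def vec.span_zero intro: vec.span_scale vec.span_base)+
      then show "x \<in> vec.span (v ` I)"
        unfolding c by (intro vec.span_sum) auto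
    qed
    moreover have "vec.independent (v ` I)" "card (v ` I) = card I"
      using vec.independent_mono[OF ind(2) image_mono[OF I(2)]]
      by (auto intro: card_image inj_on_subset[OF ind(1) I(2)])
    ultimately have "vec.dim (eigenspace A (complex_of_real e)) = card I"
      by (intro vec.dim_unique)
    moreover have "count_list (map l [0..<?n]) e = card I"
      unfolding count_list_eq_length_filter length_filter_conv_card I_def
      by (rule arg_cong[where f = card]) auto
    ultimately show ?thesis by simp
  qed
  moreover have "sorted (map l [0..<?n])"
    using g by (auto simp: greedy_eigensystem_def sorted_iff_nth_mono)
  ultimately show ?thesis
    by (simp add: ordered_eigenvalues_def)
qed

text \<open>The zero-based rank translates between the ordered column type and positions in the
  eigenvalue list.\<close>

lemma bij_betw_card_less:
  "bij_betw (\<lambda>j::'p::{finite,linorder}. card {k. k < j}) UNIV {..<CARD('p)}"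
proof -
  have lt: "card {k. k < i} < card {k. k < j}" if "i < j" for i j :: 'p
    by (rule psubset_card_mono) (use that in \<open>auto intro: less_trans\<close>)
  have inj: "inj (\<lambda>j::'p. card {k. k < j})"
    by (rule injI) (metis lt linorder_neqE nat_neq_iff)
  moreover have "(\<lambda>j::'p. card {k. k < j}) ` UNIV \<subseteq> {..<CARD('p)}"
    by (auto intro!: psubset_card_mono)
  moreover have "card ((\<lambda>j::'p. card {k. k < j}) ` UNIV) = CARD('p)"
    using inj by (rule card_image)
  ultimately show ?thesis
    unfolding bij_betw_def by (simp add: card_subset_eq)
qed

section \<open>Real diagonal matrices and unitary diagonalization\<close>

definition real_diag :: "('p \<Rightarrow> real) \<Rightarrow> complex^'p^'p" where
  "real_diag f = (\<chi> i j. if i = j then complex_of_real (f j) else 0)"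

lemma ctranspose_real_diag [simp]: "ctranspose (real_diag f) = real_diag f"
  by (simp add: ctranspose_def real_diag_def vec_eq_iff)

lemma mul_real_diag_nth: "(X ** real_diag f) $ i $ j = X $ i $ j * complex_of_real (f j)"
  by (simp add: matrix_matrix_mult_def real_diag_def if_distrib cong: if_cong)

lemma real_diag_mul: "real_diag f ** real_diag g = real_diag (\<lambda>j. f j * g j)"
  by (simp add: vec_eq_iff mul_real_diag_nth) (simp add: real_diag_def)

lemma column_mul_real_diag: "column j (X ** real_diag f) = complex_of_real (f j) *s column j X"
  by (simp add: vec_eq_iff column_def mul_real_diag_nth mult.commute)

lemma matrix_eq_columnI: "(\<And>j. column j X = column j Y) \<Longrightarrow> X = Y"
  by (simp add: column_def vec_eq_iff)

lemma column_chi [simp]: "column j (\<chi> i j. f j $ i) = f j"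
  by (simp add: column_def vec_eq_iff)

lemma orthonormal_columns_iff:
  "ctranspose X ** X = mat 1 \<longleftrightarrow> (\<forall>i j. cdot (column i X) (column j X) = (if i = j then 1 else 0))"
  by (simp add: vec_eq_iff ctranspose_mul_nth mat_def)

lemma unitaryI: "ctranspose V ** V = mat 1 \<Longrightarrow> unitary V"
  by (simp add: unitary_def matrix_left_right_inverse)

text \<open>The vacuous empty eigensystem is extended to a full one and carried to the column type
  by the rank map. Monotone \<open>d\<close> later provides the ascending order of the
  columns.\<close>

lemma hermitian_diagonalization:
  fixes G :: "complex^('p::{finite,linorder})^('p::{finite,linorder})"
  assumes G: "hermitian G"
  shows "\<exists>V d. unitary V \<and> mono d \<and> G ** V = V ** real_diag d"
proof -
  have "greedy_eigensystem G 0 v l" for v l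
    by (simp add: greedy_eigensystem_def)
  then obtain v l where g: "greedy_eigensystem G CARD('p) v l"
    using greedy_eigensystem_extend[OF G] by blast
  define r where "r = (\<lambda>j::'p. card {k. k < j})"
  have "bij_betw r UNIV {..<CARD('p)}"
    unfolding r_def by (rule bij_betw_card_less)
  then have r: "r j < CARD('p)" "r i = r j \<longleftrightarrow> i = j" for i j
    by (auto simp: bij_betw_def inj_eq)
  have r_mono: "r i \<le> r j" if "i \<le> j" for i j
    unfolding r_def using that by (auto intro!: card_mono)
  define V where "V = (\<chi> i j. v (r j) $ i)"
  have "unitary V"
    using g r by (intro unitaryI) (simp add: orthonormal_columns_iff V_def greedy_eigensystem_def)
  moreover have "G ** V = V ** real_diag (l \<circ> r)"
    using g r unfolding greedy_eigensystem_def
    by (intro matrix_eq_columnI, unfold column_mul_real_diag column_mul[of _ G]) (simp add: V_def)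
  moreover have "mono (l \<circ> r)"
    using g r r_mono by (auto simp: mono_def greedy_eigensystem_def)
  ultimately show ?thesis by blast
qed

subsection \<open>Orthonormality of local minimizers\<close>

text \<open>The filter \<open>at x within S\<close> leaves out \<open>x\<close>, so parameters with
  \<open>\<gamma> t = x\<close> are treated apart; there the inequality is trivial.\<close>

lemma local_minimizer_onD:
  assumes "local_minimizer_on f S x" "(\<gamma> \<longlongrightarrow> x) F" "\<forall>\<^sub>F t in F. \<gamma> t \<in> S"
  shows "\<forall>\<^sub>F t in F. f x \<le> f (\<gamma> t)"
proof -
  have "\<forall>\<^sub>F y in nhds x. y \<noteq> x \<longrightarrow> y \<in> S \<longrightarrow> f x \<le> f y"
    using assms(1) by (simp add: local_minimizer_on_def eventually_at_filter)
  from eventually_compose_filterlim[OF this assms(2)]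
  have "\<forall>\<^sub>F t in F. \<gamma> t \<noteq> x \<longrightarrow> \<gamma> t \<in> S \<longrightarrow> f x \<le> f (\<gamma> t)" .
  then show ?thesis
    using assms(3) by eventually_elim auto
qed

text \<open>This gives the isometric polar factor even for linearly dependent columns: nonzero
  vectors are normalized, and a zero vector admits any new orthogonal unit vector, as its
  coefficient is 0.\<close>

lemma orthogonal_family_eq_scaled_orthonormal:
  fixes y :: "'p::finite \<Rightarrow> complex^'n"
  assumes orth: "\<And>i j. i \<noteq> j \<Longrightarrow> cdot (y i) (y j) = 0" and le: "CARD('p) \<le> CARD('n)"
  shows "\<exists>u. (\<forall>i j. cdot (u i) (u j) = (if i = j then 1 else 0)) \<and> (\<forall>i. y i = norm (y i) *\<^sub>R u i)"
proof -
  define K where "K = {i. y i \<noteq> 0}"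
  have "\<exists>u. (\<forall>i\<in>K \<union> J. \<forall>j\<in>K \<union> J. cdot (u i) (u j) = (if i = j then 1 else 0)) \<and>
      (\<forall>i. y i = norm (y i) *\<^sub>R u i)" for J
  proof (induction J rule: finite_induct[OF finite])
    case 1
    show ?case
      \<comment> \<open>At a zero vector \<open>1 / 0 = 0\<close> gives \<open>u i = 0\<close>, so
        the scaling equation holds there too.\<close>
      by (rule exI[of _ "\<lambda>i. (1 / norm (y i)) *\<^sub>R y i"])
        (auto simp: K_def orth cdot_scaleR_left cdot_scaleR_right cdot_self power2_eq_square)
  next
    case (2 j J)
    then obtain u where u: "\<And>i k. i \<in> K \<union> J \<Longrightarrow> k \<in> K \<union> J \<Longrightarrow> cdot (u i) (u k) = (if i = k then 1 else 0)"
      and yu: "\<And>i. y i = norm (y i) *\<^sub>R u i"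
      by blast
    show ?case
    proof (cases "j \<in> K")
      case True
      then have "K \<union> insert j J = K \<union> J" by blast
      then show ?thesis using u yu by metis
    next
      case False
      have "card (K \<union> J) < CARD('p)"
        using False 2 by (intro psubset_card_mono) auto
      then obtain x where x: "norm x = 1" "\<And>i. i \<in> K \<union> J \<Longrightarrow> cdot (u i) x = 0"
        using exists_orthogonal_vector[of "K \<union> J" u] le by force
      have "cdot x (u i) = 0" if "i \<in> K \<union> J" for i
        using x(2)[OF that] cdot_eq_zero_commute by blast
      moreover have "cdot x x = 1"
        using x(1) by (simp add: norm_eq_1_iff_cdot)
      ultimately show ?thesis
        using u yu x False 2(2) by (intro exI[of _ "u(j := x)"]) (auto simp: K_def)
    qed
  qed
  from this[of UNIV] show ?thesis by simp
qed

text \<open>It converts the double sum of a trace estimate into the one-sided sum of the penalty;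
  the factor 2 is the one in \<open>2 * spectral_norm A\<close>.\<close>

lemma sum_offdiagonal:
  fixes g :: "'p::{finite,linorder} \<Rightarrow> 'p \<Rightarrow> real"
  assumes "\<And>i j. g i j = g j i" "\<And>i. g i i = 0"
  shows "(\<Sum>i\<in>UNIV. \<Sum>j\<in>UNIV. g i j) = 2 * (\<Sum>(i, j)\<in>{(i, j). i < j}. g i j)"
proof -
  have "(\<Sum>i\<in>UNIV. \<Sum>j\<in>UNIV. g i j) = (\<Sum>(i, j)\<in>UNIV. g i j)"
    by (simp add: sum.cartesian_product)
  also have "\<dots> = (\<Sum>(i, j)\<in>{(i, j). i < j} \<union> {(i, j). j < i}. g i j)"
    by (rule sum.mono_neutral_right) (auto simp: assms(2), metis assms(2) linorder_neqE)
  also have "\<dots> = (\<Sum>(i, j)\<in>{(i, j). i < j}. g i j) + (\<Sum>(i, j)\<in>{(i, j). j < i}. g i j)"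
    by (rule sum.union_disjoint) auto
  also have "(\<Sum>(i, j)\<in>{(i, j). j < i}. g i j) = (\<Sum>(i, j)\<in>{(i, j). i < j}. g i j)"
    by (rule sum.reindex_bij_witness[of _ prod.swap prod.swap]) (auto simp: assms(1))
  finally show ?thesis by simp
qed

lemma norm_matrix_vector_mult_le_spectral_norm: "norm (A *v x) \<le> spectral_norm A * norm x"
  unfolding spectral_norm_def by (rule onorm) (simp add: matrix_vector_mul_bounded_linear)

lemma spectral_norm_nonneg: "0 \<le> spectral_norm A"
  unfolding spectral_norm_def by (rule onorm_pos_le) (simp add: matrix_vector_mul_bounded_linear)

lemma sandwich_real_diag_nth:
  "(U ** real_diag f ** ctranspose W) $ i $ j =
    (\<Sum>k\<in>UNIV. U $ i $ k * complex_of_real (f k) * cnj (W $ j $ k))"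
  by (subst matrix_matrix_mult_def) (simp add: mul_real_diag_nth ctranspose_def)

text \<open>An affine energy that does not drop near \<open>t = 0\<close> is no smaller at
  \<open>t = 1\<close>. This bounds \<open>\<mu> * L\<close>, with \<open>L\<close> the penalty sum
  at \<open>X\<close>, by a trace difference of at most \<open>2 * spectral_norm A * L\<close>;
  hence \<open>L = 0\<close>.\<close>

lemma local_minimizer_orthonormal:
  fixes A :: "complex^'n^'n" and X :: "complex^('p::{finite,linorder})^'n"
  assumes le: "CARD('p) \<le> CARD('n)" and \<mu>: "\<mu> > 2 * spectral_norm A"
    and min: "local_minimizer_on (qL1M_energy A \<mu>) oblique X"
  shows "ctranspose X ** X = mat 1"
proof -
  define G where "G = ctranspose X ** X"
  have G_herm: "hermitian G"
    by (simp add: hermitian_def G_def ctranspose_mul)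
  have G_diag: "G $ i $ i = 1" for i
    using min by (simp add: local_minimizer_on_def oblique_def G_def)
  have G_sym: "cmod (G $ i $ j) = cmod (G $ j $ i)" for i j
    using G_herm unfolding hermitian_def ctranspose_def by (metis complex_mod_cnj vec_lambda_beta)
  obtain W d where W: "unitary W" and GW: "G ** W = W ** real_diag d"
    using hermitian_diagonalization[OF G_herm] by blast
  have WW: "ctranspose W ** W = mat 1" "W ** ctranspose W = mat 1"
    using W by (auto simp: unitary_def)
  have G_eq: "G = W ** real_diag d ** ctranspose W"
    by (metis GW WW(2) matrix_mul_assoc matrix_mul_rid)
  \<comment> \<open>The columns of \<open>X ** W\<close> are orthogonal with squared norms
    \<open>d j\<close>, so scaling them out yields a singular value decomposition of
    \<open>X\<close>.\<close>
  define y where "y j = column j (X ** W)" for j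
  have y: "cdot (y i) (y j) = (if i = j then complex_of_real (d j) else 0)" for i j
  proof -
    have "ctranspose (X ** W) ** (X ** W) = ctranspose W ** (G ** W)"
      by (simp add: G_def ctranspose_mul matrix_mul_assoc)
    also have "\<dots> = real_diag d"
      by (simp add: GW matrix_mul_assoc WW)
    finally show ?thesis
      by (simp add: y_def ctranspose_mul_nth[symmetric]) (simp add: real_diag_def)
  qed
  have d: "d j = (norm (y j))\<^sup>2" for j
    using y[of j j] by (simp add: cdot_self flip: of_real_power)
  obtain u where u: "\<And>i j. cdot (u i) (u j) = (if i = j then 1 else 0)"
    and yu: "\<And>i. y i = norm (y i) *\<^sub>R u i"
    using orthogonal_family_eq_scaled_orthonormal[OF _ le, of y] y by auto
  define U where "U = (\<chi> i j. u j $ i)"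
  have UU: "ctranspose U ** U = mat 1"
    using u by (simp add: orthonormal_columns_iff U_def)
  \<comment> \<open>The eigenvalues of the Gram matrix move linearly from \<open>d j\<close> to 1,
    with \<open>U ** ctranspose W\<close> as the fixed isometric factor.\<close>
  define e where "e t j = (1 - t) * d j + t" for t j
  define \<gamma> where "\<gamma> t = U ** real_diag (\<lambda>j. sqrt (e t j)) ** ctranspose W" for t
  have \<gamma>0: "\<gamma> 0 = X"
  proof -
    have "X ** W = U ** real_diag (\<lambda>j. sqrt (e 0 j))"
    proof (rule matrix_eq_columnI)
      fix j
      have "column j (X ** W) = norm (y j) *\<^sub>R u j"
        using yu y_def by simp
      then show "column j (X ** W) = column j (U ** real_diag (\<lambda>j. sqrt (e 0 j)))"
        unfolding column_mul_real_diag by (simp add: U_def e_def d vec_eq_iff scaleR_conv_of_real[where 'a = complex])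
    qed
    then show ?thesis
      by (metis \<gamma>_def WW(2) matrix_mul_assoc matrix_mul_rid)
  qed
  \<comment> \<open>Continuity of the square root suffices; that it is not differentiable where
    \<open>d k = 0\<close> does no harm.\<close>
  have \<gamma>_lim: "(\<gamma> \<longlongrightarrow> X) (at_right 0)"
    unfolding \<gamma>0[symmetric] \<gamma>_def
  proof (intro vec_tendstoI, unfold sandwich_real_diag_nth)
    have "((\<lambda>t. e t k) \<longlongrightarrow> e 0 k) (at_right 0)" for k
      unfolding e_def by (auto intro!: tendsto_eq_intros)
    then show "((\<lambda>t. \<Sum>k\<in>UNIV. U $ i $ k * complex_of_real (sqrt (e t k)) * cnj (W $ j $ k)) \<longlongrightarrow>
        (\<Sum>k\<in>UNIV. U $ i $ k * complex_of_real (sqrt (e 0 k)) * cnj (W $ j $ k))) (at_right 0)" for i j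
      by (intro tendsto_intros)
  qed
  \<comment> \<open>\<open>B\<close> compresses \<open>A\<close> by the isometry
    \<open>U ** ctranspose W\<close>, whose unit columns bound the entries.\<close>
  define B where "B = W ** (ctranspose U ** A ** U) ** ctranspose W"
  have B_le: "cmod (B $ i $ j) \<le> spectral_norm A" for i j
  proof -
    define Z where "Z = U ** ctranspose W"
    have "ctranspose Z ** Z = W ** (ctranspose U ** U) ** ctranspose W"
      by (simp add: Z_def ctranspose_mul matrix_mul_assoc)
    then have "ctranspose Z ** Z = mat 1"
      by (simp add: UU WW)
    then have n: "norm (column k Z) = 1" for k
      by (simp add: orthonormal_columns_iff norm_eq_1_iff_cdot)
    have "B = ctranspose Z ** A ** Z"
      by (simp add: B_def Z_def ctranspose_mul matrix_mul_assoc)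
    then have "B $ i $ j = cdot (column i Z) (A *v column j Z)"
      by (simp add: ctranspose_mul_mul_nth)
    also have "cmod \<dots> \<le> norm (A *v column j Z)"
      using cmod_cdot_le[of "column i Z" "A *v column j Z"] by (simp add: n)
    also have "\<dots> \<le> spectral_norm A"
      using norm_matrix_vector_mult_le_spectral_norm[of A "column j Z"] by (simp add: n)
    finally show ?thesis .
  qed
  have gram: "ctranspose (\<gamma> t) ** \<gamma> t = W ** real_diag (e t) ** ctranspose W"
    and tr: "trace (ctranspose (\<gamma> t) ** A ** \<gamma> t) = trace (B ** (ctranspose (\<gamma> t) ** \<gamma> t))"
    if t: "0 \<le> t" "t \<le> 1" for t
  proof -
    define S where "S = real_diag (\<lambda>j. sqrt (e t j))"
    \<comment> \<open>A convex combination of a squared norm and 1, so the square roots square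
      back.\<close>
    have "0 \<le> e t j" for j
      using t by (simp add: e_def d)
    then have SS: "S ** S = real_diag (e t)"
      by (simp add: S_def real_diag_mul)
    have "ctranspose (\<gamma> t) ** \<gamma> t = W ** (S ** (ctranspose U ** U) ** S) ** ctranspose W"
      by (simp add: \<gamma>_def S_def ctranspose_mul matrix_mul_assoc)
    also have "\<dots> = W ** real_diag (e t) ** ctranspose W"
      by (simp add: UU SS)
    finally show gram: "ctranspose (\<gamma> t) ** \<gamma> t = W ** real_diag (e t) ** ctranspose W" .
    define C where "C = ctranspose U ** A ** U"
    have "trace (ctranspose (\<gamma> t) ** A ** \<gamma> t) = trace ((W ** S) ** (C ** S ** ctranspose W))"
      by (simp add: \<gamma>_def S_def C_def ctranspose_mul matrix_mul_assoc)
    \<comment> \<open>Cyclicity of the trace joins the two factors \<open>S\<close>; inserting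
      \<open>ctranspose W ** W\<close> below then rebuilds \<open>B\<close> and the Gram
      matrix.\<close>
    also have "\<dots> = trace (C ** S ** (ctranspose W ** W) ** S)"
      by (subst trace_mul_sym) (simp add: matrix_mul_assoc)
    also have "\<dots> = trace (C ** real_diag (e t))"
      by (simp add: WW SS matrix_mul_assoc[symmetric])
    also have "\<dots> = trace (C ** (ctranspose W ** W) ** real_diag (e t) ** (ctranspose W ** W))"
      by (simp add: WW)
    also have "\<dots> = trace (W ** (C ** (ctranspose W ** W) ** real_diag (e t) ** ctranspose W))"
      by (subst (2) trace_mul_sym) (simp add: matrix_mul_assoc)
    also have "\<dots> = trace (B ** (ctranspose (\<gamma> t) ** \<gamma> t))"
      by (simp add: gram B_def C_def matrix_mul_assoc)
    finally show "trace (ctranspose (\<gamma> t) ** A ** \<gamma> t) = trace (B ** (ctranspose (\<gamma> t) ** \<gamma> t))" .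
  qed
  have gram_nth: "(ctranspose (\<gamma> t) ** \<gamma> t) $ i $ j =
      complex_of_real (1 - t) * G $ i $ j + complex_of_real t * mat 1 $ i $ j" if "0 \<le> t" "t \<le> 1" for t i j
  proof -
    \<comment> \<open>Writing the identity in the eigenbasis of \<open>G\<close> turns interpolation
      of eigenvalues into entrywise interpolation from \<open>G\<close> to the identity.\<close>
    have "mat 1 = W ** real_diag (\<lambda>_. 1) ** ctranspose W"
    proof -
      have "real_diag (\<lambda>_::'p. 1) = mat 1"
        by (simp add: real_diag_def mat_def cong: if_cong)
      then show ?thesis by (simp add: WW)
    qed
    then show ?thesis
      unfolding gram[OF that] G_eq
      by (simp add: sandwich_real_diag_nth e_def sum_distrib_left algebra_simps sum.distrib sum_subtractf)
  qed
  define L where "L = (\<Sum>(i, j)\<in>{(i::'p, j). i < j}. cmod (G $ i $ j))"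
  have energy: "qL1M_energy A \<mu> (\<gamma> t) =
      (1 - t) * (Re (trace (B ** G)) + \<mu> * L) + t * Re (trace B)" if t: "0 \<le> t" "t \<le> 1" for t
  proof -
    have trB: "trace (B ** (ctranspose (\<gamma> t) ** \<gamma> t)) =
        complex_of_real (1 - t) * trace (B ** G) + complex_of_real t * trace (B ** mat 1)"
      unfolding trace_def matrix_matrix_mult_def[of B] vec_lambda_beta gram_nth[OF t]
      by (simp add: sum_distrib_left algebra_simps sum.distrib sum_subtractf)
    \<comment> \<open>Off the diagonal only the \<open>G\<close> part survives, and
      \<open>1 - t \<ge> 0\<close> leaves the modulus.\<close>
    have pen: "(\<Sum>(i, j)\<in>{(i::'p, j). i < j}. cmod ((ctranspose (\<gamma> t) ** \<gamma> t) $ i $ j)) = (1 - t) * L"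
      unfolding L_def sum_distrib_left gram_nth[OF t]
      using t by (intro sum.cong) (auto simp: mat_def norm_mult simp flip: of_real_diff)
    show ?thesis
      unfolding qL1M_energy_def tr[OF t] trB pen by (simp add: algebra_simps)
  qed
  have small: "\<forall>\<^sub>F t in at_right 0. 0 < t \<and> t < (1::real)"
    by (auto simp: eventually_at_right_field intro: exI[of _ 1])
  have "\<forall>\<^sub>F t in at_right 0. \<gamma> t \<in> oblique"
    using small by eventually_elim (auto simp: oblique_def gram_nth G_diag mat_def)
  from local_minimizer_onD[OF min \<gamma>_lim this]
  have "\<forall>\<^sub>F t in at_right 0. 0 < t \<and> t < 1 \<and> qL1M_energy A \<mu> (\<gamma> 0) \<le> qL1M_energy A \<mu> (\<gamma> t)"
    using small by eventually_elim (simp add: \<gamma>0)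
  \<comment> \<open>As the energy is affine, a single \<open>t > 0\<close> determines the sign of
    its slope.\<close>
  then obtain t where t: "0 < t" "t < 1" "qL1M_energy A \<mu> (\<gamma> 0) \<le> qL1M_energy A \<mu> (\<gamma> t)"
    using eventually_happens[of _ "at_right (0::real)"] trivial_limit_at_right_real by blast
  then have "t * (Re (trace (B ** G)) + \<mu> * L) \<le> t * Re (trace B)"
    by (simp add: energy algebra_simps)
  then have "Re (trace (B ** G)) + \<mu> * L \<le> Re (trace B)"
    using t(1) by simp
  moreover have "Re (trace B) - Re (trace (B ** G)) \<le> spectral_norm A * (2 * L)"
  proof -
    \<comment> \<open>\<open>H\<close> has zero diagonal because the columns of \<open>X\<close> are
      unit vectors, so only the moduli summed in \<open>L\<close> enter.\<close>
    define H where "H = mat 1 - G"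
    have "trace B - trace (B ** G) = (\<Sum>i\<in>UNIV. \<Sum>j\<in>UNIV. B $ i $ j * H $ j $ i)"
    proof -
      have "trace B - trace (B ** G) = trace (B ** mat 1) - trace (B ** G)"
        by simp
      also have "\<dots> = (\<Sum>i\<in>UNIV. \<Sum>j\<in>UNIV. B $ i $ j * H $ j $ i)"
        unfolding trace_def matrix_matrix_mult_def[of B] H_def
        by (simp add: sum_subtractf algebra_simps)
      finally show ?thesis .
    qed
    then have "Re (trace B) - Re (trace (B ** G)) \<le> cmod (\<Sum>i\<in>UNIV. \<Sum>j\<in>UNIV. B $ i $ j * H $ j $ i)"
      by (metis complex_Re_le_cmod minus_complex.sel(1))
    also have "\<dots> \<le> (\<Sum>i\<in>UNIV. \<Sum>j\<in>UNIV. cmod (B $ i $ j * H $ j $ i))"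
      by (intro order_trans[OF norm_sum] sum_mono norm_sum)
    also have "\<dots> \<le> (\<Sum>i\<in>UNIV. \<Sum>j\<in>UNIV. spectral_norm A * cmod (H $ j $ i))"
      by (intro sum_mono) (simp add: norm_mult mult_right_mono B_le)
    also have "\<dots> = spectral_norm A * (\<Sum>i\<in>UNIV. \<Sum>j\<in>UNIV. cmod (H $ j $ i))"
      by (simp add: sum_distrib_left)
    also have "(\<Sum>i\<in>UNIV. \<Sum>j\<in>UNIV. cmod (H $ j $ i)) = 2 * (\<Sum>(i, j)\<in>{(i::'p, j). i < j}. cmod (H $ j $ i))"
      by (rule sum_offdiagonal) (auto simp: H_def mat_def G_diag G_sym)
    also have "(\<Sum>(i, j)\<in>{(i::'p, j). i < j}. cmod (H $ j $ i)) = L"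
      unfolding L_def by (rule sum.cong) (auto simp: H_def mat_def G_sym)
    finally show ?thesis .
  qed
  ultimately have "(\<mu> - 2 * spectral_norm A) * L \<le> 0"
    by (simp add: algebra_simps)
  then have "L \<le> 0"
    using \<mu> by (simp add: mult_le_0_iff)
  then have "L = 0"
    by (simp add: L_def antisym sum_nonneg case_prod_beta)
  then have "G $ i $ j = 0" if "i < j" for i j
    using that by (auto simp: L_def sum_nonneg_eq_0_iff case_prod_beta)
  then have "G $ i $ j = 0" if "i \<noteq> j" for i j
    using that G_sym by (metis linorder_neqE norm_eq_zero)
  then show ?thesis
    using G_diag by (auto simp: vec_eq_iff mat_def G_def)
qed

subsection \<open>Local minimizers with orthonormal columns\<close>

lemma tendsto_matrix_mult_left:
  fixes M :: "complex^'m^'k" and f :: "'a \<Rightarrow> complex^'k^'n"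
  shows "(f \<longlongrightarrow> X) F \<Longrightarrow> ((\<lambda>t. f t ** M) \<longlongrightarrow> X ** M) F"
  unfolding matrix_matrix_mult_def by (intro tendsto_vec_lambda tendsto_intros)

lemma orthonormal_in_oblique: "ctranspose X ** X = mat 1 \<Longrightarrow> X \<in> oblique"
  by (simp add: oblique_def mat_def)

lemma qL1M_energy_orthonormal:
  assumes "ctranspose X ** X = mat 1"
  shows "qL1M_energy A \<mu> X = (\<Sum>j\<in>UNIV. qform A (column j X))"
proof -
  have "(\<Sum>(i, j)\<in>{(i, j). i < j}. cmod ((ctranspose X ** X) $ i $ j)) = 0"
    by (rule sum.neutral) (auto simp: assms mat_def)
  then show ?thesis
    by (simp add: qL1M_energy_def trace_def ctranspose_mul_mul_nth qform_def)
qed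

lemma orthonormal_mul_unitary:
  assumes "ctranspose Q ** Q = mat 1" "unitary V"
  shows "ctranspose (Q ** ctranspose V) ** (Q ** ctranspose V) = mat 1"
proof -
  have "ctranspose (Q ** ctranspose V) ** (Q ** ctranspose V) = V ** (ctranspose Q ** Q) ** ctranspose V"
    by (simp add: ctranspose_mul matrix_mul_assoc)
  then show ?thesis
    using assms by (simp add: unitary_def)
qed

text \<open>By cyclicity of the trace, variations can be made on the columns of \<open>Q\<close>
  although the minimizer is \<open>Q ** ctranspose V\<close>.\<close>

lemma qL1M_energy_mul_unitary:
  assumes Q: "ctranspose Q ** Q = mat 1" and V: "unitary V"
  shows "qL1M_energy A \<mu> (Q ** ctranspose V) = qL1M_energy A \<mu> Q"
proof -
  have "trace (ctranspose (Q ** ctranspose V) ** A ** (Q ** ctranspose V)) =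
      trace (V ** (ctranspose Q ** A ** Q ** ctranspose V))"
    by (simp add: ctranspose_mul matrix_mul_assoc)
  also have "\<dots> = trace (ctranspose Q ** A ** Q ** (ctranspose V ** V))"
    by (subst trace_mul_sym) (simp add: matrix_mul_assoc)
  also have "\<dots> = trace (ctranspose Q ** A ** Q)"
    using V by (simp add: unitary_def)
  finally show ?thesis
    by (simp add: qL1M_energy_def orthonormal_mul_unitary[OF Q V] Q)
qed

text \<open>Replacing column \<open>j\<close> by the normalized \<open>q j + t *\<^sub>R w\<close>
  keeps the columns orthonormal; the claims are the first- and second-order conditions at
  \<open>t = 0\<close>.\<close>

lemma orthonormal_local_minimizer_column:
  fixes Q :: "complex^('p::{finite,linorder})^'n"
  assumes A: "hermitian A" and Q: "ctranspose Q ** Q = mat 1" and V: "unitary V"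
    and min: "local_minimizer_on (qL1M_energy A \<mu>) oblique (Q ** ctranspose V)"
    and w: "\<And>k. cdot (column k Q) w = 0"
  shows "Re (cdot w (A *v column j Q)) = 0 \<and> qform A (column j Q) * (norm w)\<^sup>2 \<le> qform A w"
proof -
  define q where "q k = column k Q" for k
  have q: "cdot (q i) (q k) = (if i = k then 1 else 0)" for i k
    using Q by (simp add: orthonormal_columns_iff q_def)
  have w': "cdot (q k) w = 0" "cdot w (q k) = 0" for k
    using w[of k] cdot_eq_zero_commute by (auto simp: q_def)
  \<comment> \<open>By Pythagoras, the squared norm of \<open>q j + t *\<^sub>R w\<close>.\<close>
  define s where "s t = 1 + t\<^sup>2 * (norm w)\<^sup>2" for t :: real
  have s: "s t > 0" for t
    by (simp add: s_def add_pos_nonneg)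
  define c where "c t = (1 / sqrt (s t)) *\<^sub>R (q j + t *\<^sub>R w)" for t
  define Y where "Y t = (\<chi> i k. (if k = j then c t else q k) $ i)" for t
  have col: "column k (Y t) = (if k = j then c t else q k)" for k t
    unfolding Y_def by (rule column_chi)
  have Y0: "Y 0 = Q"
    by (rule matrix_eq_columnI) (simp add: col c_def s_def, simp add: q_def)
  have cc: "cdot (c t) (c t) = 1" for t
  proof -
    have "cdot (q j + t *\<^sub>R w) (q j + t *\<^sub>R w) = complex_of_real (s t)"
      by (simp add: cdot_add_left cdot_add_right cdot_scaleR_left cdot_scaleR_right w' q cdot_self[of w] s_def power2_eq_square)
    moreover have "complex_of_real (sqrt (s t)) * complex_of_real (sqrt (s t)) = complex_of_real (s t)"
      using s[of t] by (simp flip: of_real_mult)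
    ultimately show ?thesis
      using s[of t] by (simp add: c_def cdot_scaleR_left cdot_scaleR_right)
  qed
  have cq: "cdot (c t) (q k) = 0" "cdot (q k) (c t) = 0" if "k \<noteq> j" for k t
    using that by (auto simp: c_def cdot_scaleR_left cdot_scaleR_right cdot_add_left cdot_add_right q w')
  have Y: "ctranspose (Y t) ** Y t = mat 1" for t
    by (auto simp: orthonormal_columns_iff col cc cq q)
  have "(Y \<longlongrightarrow> Y 0) (at 0)"
  proof -
    have "(c \<longlongrightarrow> c 0) (at 0)"
      unfolding c_def s_def by (auto intro!: tendsto_eq_intros)
    then have "((\<lambda>t. if k = j then c t else q k) \<longlongrightarrow> (if k = j then c 0 else q k)) (at 0)" for k
      by simp
    then show ?thesis
      unfolding Y_def by (intro tendsto_vec_lambda tendsto_vec_nth)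
  qed
  then have "((\<lambda>t. Y t ** ctranspose V) \<longlongrightarrow> Q ** ctranspose V) (at 0)"
    unfolding Y0 by (rule tendsto_matrix_mult_left)
  from local_minimizer_onD[OF min this]
  have "\<forall>\<^sub>F t in at 0. qL1M_energy A \<mu> (Q ** ctranspose V) \<le> qL1M_energy A \<mu> (Y t ** ctranspose V)"
    by (simp add: orthonormal_in_oblique orthonormal_mul_unitary Y V)
  then have "\<forall>\<^sub>F t in at 0. 0 \<le> t * (2 * Re (cdot w (A *v q j))) +
      t\<^sup>2 * (qform A w - qform A (q j) * (norm w)\<^sup>2)"
  proof eventually_elim
    case (elim t)
    have "(\<Sum>k\<in>UNIV. qform A (column k Q)) \<le> (\<Sum>k\<in>UNIV. qform A (column k (Y t)))"
      using elim by (simp add: qL1M_energy_mul_unitary Q Y V qL1M_energy_orthonormal)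
    moreover have "(\<Sum>k\<in>UNIV - {j}. qform A (column k Q)) = (\<Sum>k\<in>UNIV - {j}. qform A (column k (Y t)))"
      by (rule sum.cong) (auto simp: col q_def)
    moreover have "(\<Sum>k\<in>UNIV. f k) = f j + (\<Sum>k\<in>UNIV - {j}. f k)" for f :: "'p \<Rightarrow> real"
      by (rule sum.remove) simp_all
    ultimately have "qform A (column j Q) \<le> qform A (column j (Y t))"
      by (metis add_le_cancel_right)
    then have "qform A (q j) \<le> qform A (c t)"
      by (simp add: col q_def)
    also have "\<dots> = qform A (q j + t *\<^sub>R w) / s t"
      using s[of t] by (simp add: c_def qform_scaleR power_divide)
    \<comment> \<open>Clearing the denominator leaves a comparison of polynomials in
      \<open>t\<close>.\<close>
    finally have "qform A (q j) * s t \<le> qform A (q j + t *\<^sub>R w)"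
      using s[of t] by (simp add: field_simps)
    then show ?case
      unfolding qform_add_scaleR[OF A] s_def by (simp add: algebra_simps)
  qed
  from quadratic_nonneg_near_zero[OF this] show ?thesis
    by (simp add: q_def)
qed

text \<open>The columns of \<open>Q = X ** V\<close> form a greedy eigensystem: stationarity gives
  the eigenvalue equations, the second-order condition the bound on the complement. Extending it to
  a full basis identifies \<open>d\<close> as the smallest eigenvalues.\<close>

lemma orthonormal_local_minimizer_smallest_eigenvectors:
  fixes X :: "complex^('p::{finite,linorder})^'n"
  assumes A: "hermitian A" and le: "CARD('p) \<le> CARD('n)" and X: "ctranspose X ** X = mat 1"
    and min: "local_minimizer_on (qL1M_energy A \<mu>) oblique X"
  shows "\<exists>Q V. smallest_eigenvectors A Q \<and> unitary V \<and> X = Q ** ctranspose V"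
proof -
  have "hermitian (ctranspose X ** A ** X)"
    using A by (simp add: hermitian_def ctranspose_mul matrix_mul_assoc)
  then obtain V d where V: "unitary V" and "mono d"
    and d: "ctranspose X ** A ** X ** V = V ** real_diag d"
    using hermitian_diagonalization by blast
  define Q where "Q = X ** V"
  have VV: "ctranspose V ** V = mat 1" "V ** ctranspose V = mat 1"
    using V by (auto simp: unitary_def)
  have XQ: "X = Q ** ctranspose V"
    by (simp add: Q_def matrix_mul_assoc[symmetric] VV)
  have "ctranspose Q ** Q = ctranspose V ** (ctranspose X ** X) ** V"
    by (simp add: Q_def ctranspose_mul matrix_mul_assoc)
  then have Q: "ctranspose Q ** Q = mat 1"
    by (simp add: X VV)
  define q where "q k = column k Q" for k
  have q: "cdot (q i) (q k) = (if i = k then 1 else 0)" for i k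
    using Q by (simp add: orthonormal_columns_iff q_def)
  have qAq: "cdot (q i) (A *v q k) = (if i = k then complex_of_real (d k) else 0)" for i k
  proof -
    have "ctranspose Q ** A ** Q = ctranspose V ** (ctranspose X ** A ** X ** V)"
      by (simp add: Q_def ctranspose_mul matrix_mul_assoc)
    also have "\<dots> = real_diag d"
      by (simp add: d matrix_mul_assoc VV)
    finally show ?thesis
      by (simp add: q_def ctranspose_mul_mul_nth[symmetric]) (simp add: real_diag_def)
  qed
  have col: "Re (cdot w (A *v q j)) = 0" "d j * (norm w)\<^sup>2 \<le> qform A w"
    if "\<And>k. cdot (q k) w = 0" for w j
    using orthonormal_local_minimizer_column[OF A Q V, of \<mu> w j] min that qAq[of j j]
    by (auto simp: XQ[symmetric] q_def qform_def)
  have eig: "A *v q j = complex_of_real (d j) *s q j" for j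
  proof -
    \<comment> \<open>The residual is orthogonal to all columns since \<open>V\<close> diagonalizes
      the form, hence an admissible direction; its product with \<open>A *v q j\<close> is its own
      squared norm.\<close>
    define w where "w = A *v q j - complex_of_real (d j) *s q j"
    have w: "cdot (q k) w = 0" for k
      by (simp add: w_def cdot_diff_right cdot_smult_right q qAq)
    then have "cdot w (q j) = 0"
      using cdot_eq_zero_commute by blast
    then have "cdot w w = cdot w (A *v q j)"
      by (subst (2) w_def) (simp add: cdot_diff_right cdot_smult_right)
    then have "Re (cdot w w) = 0"
      using col(1)[OF w, of j] by simp
    then show ?thesis
      by (simp add: cdot_self w_def)
  qed
  define r where "r = (\<lambda>j::'p. card {k. k < j})"
  have r_bij: "bij_betw r UNIV {..<CARD('p)}"
    unfolding r_def by (rule bij_betw_card_less)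
  \<comment> \<open>The inverse of the rank, as a greedy system is indexed by position.\<close>
  define \<iota> where "\<iota> = inv_into UNIV r"
  have \<iota>r: "\<iota> (r j) = j" for j
    using r_bij by (simp add: \<iota>_def bij_betw_def)
  have r\<iota>: "r (\<iota> i) = i" if "i < CARD('p)" for i
    using r_bij that by (simp add: \<iota>_def bij_betw_inv_into_right)
  have r_less: "r j < CARD('p)" for j
    using r_bij by (auto simp: bij_betw_def)
  have \<iota>_mono: "\<iota> i \<le> \<iota> k" if "i \<le> k" "k < CARD('p)" for i k
  proof (rule ccontr)
    assume "\<not> \<iota> i \<le> \<iota> k"
    then have "r (\<iota> k) \<le> r (\<iota> i)"
      unfolding r_def by (intro card_mono) auto
    then show False
      using that r\<iota> \<open>\<not> \<iota> i \<le> \<iota> k\<close> by simp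
  qed
  have "greedy_eigensystem A CARD('p) (q \<circ> \<iota>) (d \<circ> \<iota>)"
    unfolding greedy_eigensystem_def
  proof (intro conjI allI impI)
    show "cdot ((q \<circ> \<iota>) i) ((q \<circ> \<iota>) k) = (if i = k then 1 else 0)" if "i < CARD('p)" "k < CARD('p)" for i k
      using that r\<iota> by (auto simp: q) metis
    show "(d \<circ> \<iota>) i \<le> (d \<circ> \<iota>) k" if "i \<le> k" "k < CARD('p)" for i k
      using that \<iota>_mono \<open>mono d\<close> by (auto simp: mono_def)
    show "(d \<circ> \<iota>) i * (norm w)\<^sup>2 \<le> qform A w" if "\<forall>k<CARD('p). cdot ((q \<circ> \<iota>) k) w = 0" for i w
      using that col(2)[of w "\<iota> i"] \<iota>r r_less by (metis comp_apply)
  qed (simp add: eig)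
  then obtain v l where vl: "greedy_eigensystem A CARD('n) v l" "\<And>i. i < CARD('p) \<Longrightarrow> l i = d (\<iota> i)"
    using greedy_eigensystem_extend[OF A _ le] by (metis comp_apply)
  define es where "es = map l [0..<CARD('n)]"
  have "ordered_eigenvalues A es"
    unfolding es_def using A vl(1) by (rule greedy_eigensystem_imp_ordered_eigenvalues)
  \<comment> \<open>The extension keeps the first \<open>CARD('p)\<close> eigenvalues.\<close>
  moreover have es_r: "es ! card {k. k < j} = d j" for j :: 'p
    using r_less[of j] le vl(2) \<iota>r by (simp add: es_def r_def)
  have "A ** Q = Q ** real_diag d"
    by (rule matrix_eq_columnI, unfold column_mul_real_diag column_mul[of _ A]) (use eig q_def in simp)
  ultimately have "smallest_eigenvectors A Q"
    using Q unfolding smallest_eigenvectors_def real_diag_def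
    by (intro conjI exI[of _ es]) (simp_all add: es_r cong: if_cong)
  then show ?thesis
    using V XQ by blast
qed

subsection \<open>Global minimizers\<close>

lemma compact_oblique: "compact (oblique :: (complex^'p^'n) set)"
proof -
  have entry: "cmod (X $ i $ j) \<le> 1" if "X \<in> oblique" for X :: "complex^'p^'n" and i j
  proof -
    have "norm (column j X) = 1"
      using that by (simp add: oblique_def ctranspose_mul_nth norm_eq_1_iff_cdot)
    then show ?thesis
      using Finite_Cartesian_Product.norm_nth_le[of "column j X" i] by (simp add: column_def)
  qed
  \<comment> \<open>The all-ones matrix dominates every \<open>X\<close> entrywise.\<close>
  have "norm X \<le> norm ((\<chi> i j. 1) :: complex^'p^'n)" if "X \<in> oblique" for X :: "complex^'p^'n"
    using entry[OF that] by (intro norm_le_componentwise_cart) simp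
  then have "bounded (oblique :: (complex^'p^'n) set)"
    unfolding bounded_iff by blast
  moreover have "closed (oblique :: (complex^'p^'n) set)"
    unfolding oblique_def ctranspose_def matrix_matrix_mult_def vec_lambda_beta
    by (intro closed_Collect_all closed_Collect_eq continuous_intros)
  ultimately show ?thesis
    by (simp add: compact_eq_bounded_closed)
qed

lemma continuous_on_qL1M_energy: "continuous_on S (qL1M_energy A \<mu>)"
  unfolding qL1M_energy_def trace_def ctranspose_def matrix_matrix_mult_def vec_lambda_beta case_prod_beta
  by (intro continuous_intros)

text \<open>The form takes the eigenvalues as values on the columns, and the ordered list is unique,
  so the energy is the same for all \<open>Q\<close> and \<open>V\<close>.\<close>

lemma qL1M_energy_smallest_eigenvectors:
  fixes Q :: "complex^('p::{finite,linorder})^'n"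
  assumes Q: "smallest_eigenvectors A Q" and V: "unitary V" and es: "ordered_eigenvalues A es"
  shows "qL1M_energy A \<mu> (Q ** ctranspose V) = (\<Sum>j\<in>(UNIV::'p set). es ! card {k. k < j})"
proof -
  obtain fs where QQ: "ctranspose Q ** Q = mat 1" and fs: "ordered_eigenvalues A fs"
    and AQ: "A ** Q = Q ** real_diag (\<lambda>j. fs ! card {k. k < j})"
    using Q unfolding smallest_eigenvectors_def real_diag_def by blast
  have "fs = es"
    using fs es by (rule ordered_eigenvalues_unique)
  note AQ = AQ[unfolded this]
  have "A *v column j Q = complex_of_real (es ! card {k. k < j}) *s column j Q" for j
    using arg_cong[OF AQ, of "column j"] unfolding column_mul_real_diag by (simp add: column_mul)
  then have "qform A (column j Q) = es ! card {k. k < j}" for j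
    using QQ by (simp add: qform_def cdot_smult_right orthonormal_columns_iff)
  then show ?thesis
    by (simp add: qL1M_energy_mul_unitary[OF QQ V] qL1M_energy_orthonormal[OF QQ])
qed

theorem theorem2p8:
  fixes A :: "complex^'n^'n" and \<mu> :: real
  assumes "hermitian A"
    and "CARD('p::{finite,linorder}) < CARD('n)"
    and "\<mu> > 16 * real CARD('p) * spectral_norm A"
    and "\<mu> > 0"
  shows
    "(\<forall>X :: complex^('p::{finite,linorder})^'n. local_minimizer_on (qL1M_energy A \<mu>) oblique X \<longrightarrow>
        (\<exists>(Q :: complex^('p::{finite,linorder})^'n) (V :: complex^('p::{finite,linorder})^('p::{finite,linorder})).
           smallest_eigenvectors A Q \<and> unitary V \<and> X = Q ** ctranspose V)) \<and>
     (\<forall>(Q :: complex^('p::{finite,linorder})^'n) (V :: complex^('p::{finite,linorder})^('p::{finite,linorder})).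
        smallest_eigenvectors A Q \<and> unitary V \<longrightarrow>
        local_minimizer_on (qL1M_energy A \<mu>) oblique (Q ** ctranspose V)) \<and>
     (\<forall>X :: complex^('p::{finite,linorder})^'n. local_minimizer_on (qL1M_energy A \<mu>) oblique X \<longrightarrow>
        is_arg_min (qL1M_energy A \<mu>) (\<lambda>Y. Y \<in> oblique) X)"
proof -
  let ?E = "qL1M_energy A \<mu> :: complex^('p::{finite,linorder})^'n \<Rightarrow> real"
  \<comment> \<open>An index type is nonempty, so \<open>16 * real CARD('p)\<close> is at least the
    2 of the descent argument.\<close>
  have "1 \<le> CARD('p)"
    by (simp add: Suc_le_eq)
  then have "2 \<le> 16 * real CARD('p)"
    by linarith
  then have "2 * spectral_norm A \<le> 16 * real CARD('p) * spectral_norm A"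
    by (rule mult_right_mono[OF _ spectral_norm_nonneg])
  then have \<mu>: "2 * spectral_norm A < \<mu>"
    using assms(3) by (rule le_less_trans)
  have le: "CARD('p) \<le> CARD('n)"
    using assms(2) by simp
  have form: "\<exists>Q V. smallest_eigenvectors A Q \<and> unitary V \<and> X = Q ** ctranspose V"
    if "local_minimizer_on ?E oblique X" for X
    by (rule orthonormal_local_minimizer_smallest_eigenvectors[OF assms(1) le
          local_minimizer_orthonormal[OF le \<mu> that] that])
  have global: "Q ** ctranspose V \<in> oblique \<and> (\<forall>Y\<in>oblique. ?E (Q ** ctranspose V) \<le> ?E Y)"
    if Q: "smallest_eigenvectors A Q" and V: "unitary V" for Q :: "complex^('p::{finite,linorder})^'n" and V
  proof -
    have obl: "Q ** ctranspose V \<in> oblique"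
      using Q V by (simp add: smallest_eigenvectors_def orthonormal_in_oblique orthonormal_mul_unitary)
    \<comment> \<open>\<open>Q ** ctranspose V\<close> shows the compact set nonempty, so a
      minimizer \<open>X\<close> exists. It is also a local one, hence of the same form and with the
      same energy.\<close>
    then obtain X where X: "X \<in> oblique" "\<forall>Y\<in>oblique. ?E X \<le> ?E Y"
      using continuous_attains_inf[OF compact_oblique _ continuous_on_qL1M_energy, of A \<mu>] by blast
    then have "local_minimizer_on ?E oblique X"
      by (auto simp: local_minimizer_on_def eventually_at_filter)
    then obtain Q' V' where "smallest_eigenvectors A Q'" "unitary V'" "X = Q' ** ctranspose V'"
      using form by blast
    moreover from Q obtain es where "ordered_eigenvalues A es"
      by (auto simp: smallest_eigenvectors_def)
    ultimately have "?E (Q ** ctranspose V) = ?E X"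
      using Q V by (simp add: qL1M_energy_smallest_eigenvectors)
    then show ?thesis
      using X obl by simp
  qed
  have "local_minimizer_on ?E oblique (Q ** ctranspose V)"
    if "smallest_eigenvectors A Q" "unitary V" for Q :: "complex^('p::{finite,linorder})^'n" and V
    using global[OF that] by (auto simp: local_minimizer_on_def eventually_at_filter)
  moreover have "is_arg_min ?E (\<lambda>Y. Y \<in> oblique) X" if "local_minimizer_on ?E oblique X" for X
    using form[OF that] global by (auto simp: is_arg_min_linorder)
  ultimately show ?thesis
    using form by blast
qed

end
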